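(* The retroactive pool is a correct implementation of a lock-swap enabled liquidity pool. That is, for every trace of a retroactive pool $p$ the following two properties hold. (i) Asset positivity: at all times, the asset amounts $a,b$ held by $p$ satisfy $a>0$ and $b>0$. (ii) Product preservation: for every operation $(a^*,b^* )\leftarrow p.\mathbf{reclaim}(t)$ in the trace, if $\Delta a,\Delta b$ are the values given as arguments in the earlier matching operation $t\leftarrow p.\mathbf{provide}(\Delta a,\Delta b)$ or $t\leftarrow p.\mathbf{init}(\Delta a,\Delta b)$ that produced $t$, then $a^*b^*\ge \Delta a\,\Delta b$.
   Context: **Liquidity token portions and locks.** A liquidity token portion is an object carrying a non-negative real number, its amount. A lock is an object carrying a pair $(\Delta a,\Delta b)$ of reals, exactly one positive and exactly one negative. Portions (resp. locks) produced by different operations are regarded as different objects even if their contents coincide. **Non-proportional-provide pools.** Such a pool has a state $(a,b),z$ of positive reals and the following operations. - $t\leftarrow\mathbf{init}(\Delta a,\Delta b)$ ($\Delta a,\Delta b>0$; must be the first operation, performed once): sets $(a,b)=(\Delta a,\Delta b)$, $z=1$, returns a portion of amount $1$. - $\Delta b\leftarrow\mathbf{swapAtoB}(\Delta a)$ ($\Delta a>0$): returns some negative real $\Delta b$ with $(a+\Delta a)(b+\Delta b)\ge ab$; the state becomes $(a+\Delta a,b+\Delta b)$, $z$ unchanged. The swap is exact if equality holds. - $\Delta a\leftarrow\mathbf{swapBtoA}(\Delta b)$ ($\Delta b>0$): returns some negative real $\Delta a$ with $(a+\Delta a)(b+\Delta b)\ge ab$; the state becomes $(a+\Delta a,b+\Delta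 b)$, $z$ unchanged. - $t\leftarrow\mathbf{provide}(\Delta a,\Delta b)$ ($\Delta a,\Delta b\ge0$): the state becomes $(a+\Delta a,b+\Delta b)$, $z+m$, with $m=\epsilon z$, $\epsilon=\sqrt{\frac{(a+\Delta a)(b+\Delta b)}{ab}}-1$; returns a portion of amount $m$. - $(a^*,b^* )\leftarrow\mathbf{reclaim}(t)$, where $t$ was output by an earlier $\mathbf{init}$ or $\mathbf{provide}$ and not yet reclaimed; permitted only if the amount $m$ of $t$ satisfies $m<z$; returns $a^*=am/z$, $b^*=bm/z$; the state becomes $(a-a^*,b-b^* )$, $z-m$. A trace of such a pool is a sequence of operations starting with $\mathbf{init}$ and satisfying these constraints. **Lock-swap enabled pools (operations).** The state includes asset amounts $(a,b)$ and a token count $z$. The operations are as follows. - $t\leftarrow p.\mathbf{init}(\Delta a,\Delta b)$ ($\Delta a,\Delta b>0$; first operation, performed once): sets $(a,b)=(\Delta a,\Delta b)$, $z=1$, returns a portion $t$ of amount $1$. - $L\leftarrow p.\mathbf{lockSwapAtoB}(\Delta a)$ ($\Delta a>0$): returns a lock $L=(\Delta a,\Delta b)$ with $\Delta b<0$. $L\leftarrow p.\mathbf{lockSwapBtoA}(\Delta b)$ ($\Delta b>0$): returns a lock $L=(\Delta a,\Delta b)$ with $\Delta a<0$. Neither changes $(a,b)$ or $z$. A lock is active (unresolved) from the time it is granted until it is executed or canceled; every lock is required to be eventually executed or canceled. - $p.\mathbf{execute}(L)$, for an active lock $L=(\Delta a,\Delta b)$: changes $(a,b)$ to $(a+\Delta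 a,b+\Delta b)$; $L$ is no longer active. - $p.\mathbf{cancel}(L)$, for an active lock $L$: changes neither $(a,b)$ nor $z$; $L$ is no longer active. - $t\leftarrow p.\mathbf{provide}(\Delta a,\Delta b)$ ($\Delta a,\Delta b\ge0$): immediately changes $(a,b)$ to $(a+\Delta a,b+\Delta b)$. A portion $t$ is minted, but $t$ becomes available for later operations (and its amount is added to $z$) only when all locks that were active at the time of the $\mathbf{provide}$ have been executed or canceled; until then the operation is unresolved. - $(a^*,b^* )\leftarrow p.\mathbf{reclaim}(t)$, where $t$ is an available portion, output by an earlier $\mathbf{provide}$ or $\mathbf{init}$ and not previously given to a $\mathbf{reclaim}$: the change of $(a,b)$ to $(a-a^*,b-b^* )$ and the return of $(a^*,b^* )$, with $a^*,b^*\ge 0$, take place only when all locks that were active at the time of the $\mathbf{reclaim}$ have been executed or canceled; until then the operation is unresolved. Permitted only if $m<z$, where $m$ is the amount of $t$. **The retroactive pool.** This is the following implementation, specifying the values returned. Besides $a,b,z$, the state contains a set $T$ of traces of non-proportional-provide pools (the virtual pools, each with its own asset amounts and token count), one trace for each way $\rho$ of choosing, for each currently active lock, whether to execute or cancel it (so $|T|=2^k$ if there are $k$ active locks). The trace for $\rho$ is obtained from the trace of $p$ so far as follows: keep $\mathbf{init}$; keep each $\mathbf{provide}$ and $\mathbf{reclaim}$ as the non-proportional-provide operation with the same inputs (the outputs computed according to the definition of non-proportional-provide pools); delete $\mathbf{execute}$ and $\mathbf{cancel}$ operations; delete lock-swaps whose lock has been canceled or is to be canceled according to $\rho$; replace each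 lock-swap whose lock $(\Delta a,\Delta b)$ has been executed or is to be executed according to $\rho$ by the corresponding $\mathbf{swapAtoB}$ or $\mathbf{swapBtoA}$ with the same $\Delta a,\Delta b$. The set $T$ is maintained as follows. - $\mathbf{init}$: $T$ consists of the single trace with the same $\mathbf{init}$. - $\mathbf{execute}(L)$ (resp. $\mathbf{cancel}(L)$): remove from $T$ all traces in which $L$ is chosen to be canceled (resp. executed). - $\mathbf{provide}$, $\mathbf{reclaim}$: extend every trace in $T$ with the corresponding non-proportional-provide operation. A $\mathbf{reclaim}(t)$ is performed only if all the extended traces are legal, i.e. the amount of $t$ is less than the token count of every virtual pool. (Since $t$ is available, the operation producing $t$ lies in a common prefix of all traces in $T$, so its amount is the same in all of them.) - $\mathbf{lockSwapAtoB}(\Delta a)$: for each trace in $T$, consider its extension by a permitted operation $\Delta b\leftarrow\mathbf{swapAtoB}(\Delta a)$ (exact, or with some positive fee), and let $\beta<0$ be the largest of the resulting values $\Delta b$ over all traces in $T$. The lock returned is $(\Delta a,\beta)$, and the new set $T$ consists of all old traces (new lock canceled) together with all old traces extended by $\beta\leftarrow\mathbf{swapAtoB}(\Delta a)$ (new lock executed). - $\mathbf{lockSwapBtoA}(\Delta b)$: symmetrically, using extensions by permitted operations $\Delta a\leftarrow\mathbf{swapBtoA}(\Delta b)$, with $\alpha<0$ the largest resulting value of $\Delta a$; the lock returned is $(\alpha,\Delta b)$. The retroactive trace of $p$ is the non-proportional-provide trace formed by the growing initial part on which all traces in $T$ permanently agree: a $\mathbf{provide}$ or $\mathbf{reclaim}$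 becomes part of it exactly when all locks active at the time of that operation have been resolved. At that moment (in trace order, if several operations are finalized at once) the operation is finalized: for a $\mathbf{provide}$, the amount of $t$ is the amount computed in the retroactive trace and is added to $z$; for a $\mathbf{reclaim}$, $(a^*,b^* )$ are the amounts computed in the retroactive trace, they are subtracted from $(a,b)$, and $z$ is reduced by the amount of $t$. *)

theory Defs
  imports Complex_Main "HOL-Library.Sublist"
begin

section \<open>Non-proportional-provide pools\<close>

text \<open>A portion is represented by its identity only. Its amount is part of the pool state: when a
  portion is minted by a pending \<open>provide\<close>, its amount is not yet determined and may differ between
  virtual pools.\<close>

type_synonym portion = nat

record npp =
  assetA :: real
  assetB :: real
  tokens :: real
  amount :: "portion \<Rightarrow> real option"         \<comment> \<open>all portions output so far, also the reclaimed ones\<close>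
  paid :: "portion \<Rightarrow> (real \<times> real) option"  \<comment> \<open>the values \<open>(a*, b*)\<close> returned by \<open>reclaim\<close>\<close>

text \<open>The arguments of a swap are its input followed by its output. The outputs of \<open>provide\<close> and
  \<open>reclaim\<close> are functions of the state and are recorded there.\<close>

datatype npp_op =
    NInit portion real real
  | NSwapAtoB real real
  | NSwapBtoA real real
  | NProvide portion real real
  | NReclaim portion

definition provide_amount :: "npp \<Rightarrow> real \<Rightarrow> real \<Rightarrow> real" where
  "provide_amount s da db =
     (sqrt ((assetA s + da) * (assetB s + db) / (assetA s * assetB s)) - 1) * tokens s"

definition reclaim_values :: "npp \<Rightarrow> portion \<Rightarrow> real \<times> real" where
  "reclaim_values s t =
     (assetA s * the (amount s t) / tokens s, assetB s * the (amount s t) / tokens s)"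

fun npp_permitted :: "npp \<Rightarrow> npp_op \<Rightarrow> bool" where
  "npp_permitted s (NInit t da db) \<longleftrightarrow> False"
| "npp_permitted s (NSwapAtoB da db) \<longleftrightarrow>
     0 < da \<and> db < 0 \<and> (assetA s + da) * (assetB s + db) \<ge> assetA s * assetB s"
| "npp_permitted s (NSwapBtoA db da) \<longleftrightarrow>
     0 < db \<and> da < 0 \<and> (assetA s + da) * (assetB s + db) \<ge> assetA s * assetB s"
| "npp_permitted s (NProvide t da db) \<longleftrightarrow> 0 \<le> da \<and> 0 \<le> db \<and> amount s t = None"
| "npp_permitted s (NReclaim t) \<longleftrightarrow> (\<exists>m. amount s t = Some m \<and> paid s t = None \<and> m < tokens s)"

fun npp_apply :: "npp_op \<Rightarrow> npp \<Rightarrow> npp" where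
  "npp_apply (NInit t da db) s =
     \<lparr>assetA = da, assetB = db, tokens = 1, amount = [t \<mapsto> 1], paid = Map.empty\<rparr>"
| "npp_apply (NSwapAtoB da db) s = s\<lparr>assetA := assetA s + da, assetB := assetB s + db\<rparr>"
| "npp_apply (NSwapBtoA db da) s = s\<lparr>assetA := assetA s + da, assetB := assetB s + db\<rparr>"
| "npp_apply (NProvide t da db) s =
     s\<lparr>assetA := assetA s + da,
       assetB := assetB s + db,
       tokens := tokens s + provide_amount s da db,
       amount := (amount s)(t \<mapsto> provide_amount s da db)\<rparr>"
| "npp_apply (NReclaim t) s =
     s\<lparr>assetA := assetA s - fst (reclaim_values s t),
       assetB := assetB s - snd (reclaim_values s t),
       tokens := tokens s - the (amount s t),
       paid := (paid s)(t \<mapsto> reclaim_values s t)\<rparr>"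

text \<open>The start value of the fold is irrelevant: traces begin with \<^const>\<open>NInit\<close>, which overwrites
  the whole state.\<close>

definition npp_final :: "npp_op list \<Rightarrow> npp" where
  "npp_final \<tau> = fold npp_apply \<tau>
     \<lparr>assetA = 0, assetB = 0, tokens = 0, amount = Map.empty, paid = Map.empty\<rparr>"

inductive npp_trace :: "npp_op list \<Rightarrow> bool" where
  init: "0 < da \<Longrightarrow> 0 < db \<Longrightarrow> npp_trace [NInit t da db]"
| step: "npp_trace \<tau> \<Longrightarrow> npp_permitted (npp_final \<tau>) x \<Longrightarrow> npp_trace (\<tau> @ [x])"


section \<open>The retroactive pool\<close>

text \<open>The tag separates locks with equal contents.\<close>

datatype lock = Lock (lock_tag: nat) (lock_da: real) (lock_db: real)

datatype unresolved = Minting portion | Paying portion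

text \<open>The inherited fields \<^const>\<open>assetA\<close>, \<^const>\<open>assetB\<close>, \<^const>\<open>tokens\<close> are those of the pool itself;
  \<^const>\<open>amount\<close> is defined exactly on the portions that have become available, and \<^const>\<open>paid\<close> exactly on the portions
  whose \<open>reclaim\<close> is finalized.

  The component \<open>virtual\<close> is the set \<open>T\<close> of the traces of the virtual pools. Each trace \<open>\<tau>\<close> is paired with the set \<open>\<rho>\<close> of the locks that
  have been executed or are to be executed in it; all other locks granted so far have been canceled
  or are to be canceled in \<open>\<tau>\<close>. The pairing keeps apart traces that differ in \<open>\<rho>\<close> but happen to
  consist of the same operations.

  The component \<open>waiting\<close> lists the unresolved operations in trace order, each with those of the
  locks active at the time of the operation that have not been executed or canceled since.\<close>

record retro_pool = npp +
  minted :: "portion set"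
  requested :: "portion set"     \<comment> \<open>portions given to some \<open>reclaim\<close>, resolved or not\<close>
  granted :: "lock set"
  active :: "lock set"
  virtual :: "(lock set \<times> npp_op list) set"
  waiting :: "(unresolved \<times> lock set) list"

datatype op =
    Init portion real real
  | LockSwapAtoB real lock
  | LockSwapBtoA real lock
  | Execute lock
  | Cancel lock
  | Provide portion real real
  | Reclaim portion

text \<open>An agreement of all traces in \<open>T\<close> is permanent, because the traces in \<open>T\<close> are only ever extended
  or removed.\<close>

definition retroactive_trace :: "retro_pool \<Rightarrow> npp_op list" where
  "retroactive_trace s = Longest_common_prefix (snd ` virtual s)"

fun finalize :: "unresolved \<Rightarrow> retro_pool \<Rightarrow> retro_pool" where
  "finalize (Minting t) s =
     (let m = the (amount (npp_final (retroactive_trace s)) t)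
      in s\<lparr>tokens := tokens s + m, amount := (amount s)(t \<mapsto> m)\<rparr>)"
| "finalize (Paying t) s =
     (let (a', b') = the (paid (npp_final (retroactive_trace s)) t)
      in s\<lparr>assetA := assetA s - a',
           assetB := assetB s - b',
           tokens := tokens s - the (amount s t),
           paid := (paid s)(t \<mapsto> (a', b'))\<rparr>)"

definition finalize_ready :: "retro_pool \<Rightarrow> retro_pool" where
  "finalize_ready s =
     fold finalize (map fst (filter (\<lambda>(u, W). W = {}) (waiting s)))
       (s\<lparr>waiting := filter (\<lambda>(u, W). W \<noteq> {}) (waiting s)\<rparr>)"

definition resolve_lock :: "lock \<Rightarrow> retro_pool \<Rightarrow> retro_pool" where
  "resolve_lock L s = finalize_ready
     (s\<lparr>active := active s - {L}, waiting := map (\<lambda>(u, W). (u, W - {L})) (waiting s)\<rparr>)"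

definition extend_virtual :: "npp_op \<Rightarrow> retro_pool \<Rightarrow> retro_pool" where
  "extend_virtual x s = s\<lparr>virtual := (\<lambda>(\<rho>, \<tau>). (\<rho>, \<tau> @ [x])) ` virtual s\<rparr>"

definition grant_lock :: "lock \<Rightarrow> npp_op \<Rightarrow> retro_pool \<Rightarrow> retro_pool" where
  "grant_lock L x s =
     s\<lparr>granted := insert L (granted s),
       active := insert L (active s),
       virtual := virtual s \<union> (\<lambda>(\<rho>, \<tau>). (insert L \<rho>, \<tau> @ [x])) ` virtual s\<rparr>"

definition retro_init :: "portion \<Rightarrow> real \<Rightarrow> real \<Rightarrow> retro_pool" where
  "retro_init t da db =
     \<lparr>assetA = da, assetB = db, tokens = 1, amount = [t \<mapsto> 1], paid = Map.empty,
      minted = {t}, requested = {}, granted = {}, active = {},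
      virtual = {({}, [NInit t da db])}, waiting = []\<rparr>"

text \<open>In the two rules for lock-swaps, \<open>f\<close> gives for each virtual pool the output of the permitted
  swap considered there. The choice of \<open>f\<close>, and thus of the fees, is arbitrary.\<close>

inductive retro_step :: "retro_pool \<Rightarrow> op \<Rightarrow> retro_pool \<Rightarrow> bool" where
  lockSwapAtoB:
    "\<lbrakk>0 < da;
      \<forall>(\<rho>, \<tau>) \<in> virtual s. npp_trace (\<tau> @ [NSwapAtoB da (f (\<rho>, \<tau>))]);
      \<beta> = Max (f ` virtual s);
      L = Lock i da \<beta>; L \<notin> granted s\<rbrakk>
     \<Longrightarrow> retro_step s (LockSwapAtoB da L) (grant_lock L (NSwapAtoB da \<beta>) s)"
| lockSwapBtoA:
    "\<lbrakk>0 < db;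
      \<forall>(\<rho>, \<tau>) \<in> virtual s. npp_trace (\<tau> @ [NSwapBtoA db (f (\<rho>, \<tau>))]);
      \<alpha> = Max (f ` virtual s);
      L = Lock i \<alpha> db; L \<notin> granted s\<rbrakk>
     \<Longrightarrow> retro_step s (LockSwapBtoA db L) (grant_lock L (NSwapBtoA db \<alpha>) s)"
| execute:
    "L \<in> active s
     \<Longrightarrow> retro_step s (Execute L) (resolve_lock L
           (s\<lparr>assetA := assetA s + lock_da L,
              assetB := assetB s + lock_db L,
              virtual := {(\<rho>, \<tau>) \<in> virtual s. L \<in> \<rho>}\<rparr>))"
| cancel:
    "L \<in> active s
     \<Longrightarrow> retro_step s (Cancel L) (resolve_lock L (s\<lparr>virtual := {(\<rho>, \<tau>) \<in> virtual s. L \<notin> \<rho>}\<rparr>))"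
| provide:
    "\<lbrakk>0 \<le> da; 0 \<le> db; t \<notin> minted s\<rbrakk>
     \<Longrightarrow> retro_step s (Provide t da db) (finalize_ready (extend_virtual (NProvide t da db)
           (s\<lparr>assetA := assetA s + da,
              assetB := assetB s + db,
              minted := insert t (minted s),
              waiting := waiting s @ [(Minting t, active s)]\<rparr>)))"
| reclaim:
    "\<lbrakk>amount s t = Some m; t \<notin> requested s; m < tokens s;
      \<forall>(\<rho>, \<tau>) \<in> virtual s. npp_trace (\<tau> @ [NReclaim t])\<rbrakk>
     \<Longrightarrow> retro_step s (Reclaim t) (finalize_ready (extend_virtual (NReclaim t)
           (s\<lparr>requested := insert t (requested s),
              waiting := waiting s @ [(Paying t, active s)]\<rparr>)))"

text \<open>Each operation of a trace is paired with the state of the pool after it. Some locks may still be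
  active at the end, so that the initial parts of a trace are traces, too.\<close>

inductive retro_trace :: "(op \<times> retro_pool) list \<Rightarrow> bool" where
  init: "0 < da \<Longrightarrow> 0 < db \<Longrightarrow> retro_trace [(Init t da db, retro_init t da db)]"
| step: "retro_trace tr \<Longrightarrow> retro_step (snd (last tr)) x s \<Longrightarrow> retro_trace (tr @ [(x, s)])"

end

theory Submission
  imports Defs
begin

text \<open>In a non-proportional-provide pool the value \<open>sqrt (a * b) / z\<close> of one token never decreases,
  and a \<open>provide\<close> mints a portion worth
  \<open>sqrt ((a + \<Delta>a) * (b + \<Delta>b)) - sqrt (a * b) \<ge> sqrt (\<Delta>a * \<Delta>b)\<close> by the Cauchy-Schwarz inequality;
  this is product preservation for a single virtual pool. A lock carries the worst output over all
  virtual pools, so its execution is a permitted swap in each of them, and every finalized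
  \<open>reclaim\<close> returns what all virtual pools return. Finally, the pool holds at least the assets of the
  virtual pool that cancels all active locks, since that pool has already paid out the pending
  \<open>reclaim\<close> operations; hence its assets are positive.\<close>

section \<open>Non-proportional-provide pools\<close>

lemma npp_final_snoc [simp]: "npp_final (\<tau> @ [x]) = npp_apply x (npp_final \<tau>)"
  by (simp add: npp_final_def)

lemma paid_npp_final_Nil [simp]: "paid (npp_final []) = Map.empty"
  by (simp add: npp_final_def)

lemma npp_final_init [simp]:
  "npp_final [NInit t da db] =
    \<lparr>assetA = da, assetB = db, tokens = 1, amount = [t \<mapsto> 1], paid = Map.empty\<rparr>"
  by (simp add: npp_final_def)

lemma npp_trace_not_Nil [simp]: "\<not> npp_trace []"
  using npp_trace.simps by blast

lemma npp_trace_snoc_iff: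
  assumes "npp_trace \<tau>"
  shows "npp_trace (\<tau> @ [x]) \<longleftrightarrow> npp_permitted (npp_final \<tau>) x"
proof
  assume "npp_trace (\<tau> @ [x])"
  then show "npp_permitted (npp_final \<tau>) x"
    using assms by cases auto
qed (use assms npp_trace.step in blast)

text \<open>The retroactive trace is a common prefix of virtual traces; this makes it a trace as
  soon as it is nonempty.\<close>

lemma npp_trace_prefix: "npp_trace \<tau> \<Longrightarrow> prefix p \<tau> \<Longrightarrow> p = [] \<or> npp_trace p"
proof (induction rule: npp_trace.induct)
  case (init da db t)
  then show ?case by (auto simp: prefix_Cons intro: npp_trace.init)
next
  case (step \<tau> x)
  then show ?case by (auto intro: npp_trace.step)
qed

lemma paid_npp_apply:
  "npp_permitted n x \<Longrightarrow> paid n t = Some v \<Longrightarrow> paid (npp_apply x n) t = Some v"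
  by (cases x) auto

text \<open>A portion can be reclaimed only once, so no later operation overwrites a recorded
  payment. This carries a payment from a shared initial part to every virtual pool.\<close>

lemma paid_prefix:
  assumes "npp_trace \<tau>" "prefix p \<tau>" "paid (npp_final p) t = Some v"
  shows "paid (npp_final \<tau>) t = Some v"
  using assms
proof (induction rule: npp_trace.induct)
  case (init da db t)
  then show ?case by (auto simp: prefix_Cons)
next
  case (step \<tau> x)
  then show ?case using paid_npp_apply[of _ x t v] by (metis npp_final_snoc prefix_snoc)
qed

section \<open>Solvency and the value of a token\<close>

lemma sqrt_prod_add_le:
  fixes a b c d :: real
  assumes "0 \<le> a" "0 \<le> b" "0 \<le> c" "0 \<le> d"
  shows "sqrt (a * b) + sqrt (c * d) \<le> sqrt ((a + c) * (b + d))"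
proof (rule real_le_rsqrt)
  \<comment> \<open>The factors of the cross term are regrouped so that the bound 2xy \<le> x^2 +
    y^2 yields exactly the mixed products of (a + c)(b + d).\<close>
  have "2 * sqrt (a * b) * sqrt (c * d) = 2 * sqrt (a * d) * sqrt (c * b)"
    by (simp add: real_sqrt_mult)
  also have "\<dots> \<le> (sqrt (a * d))\<^sup>2 + (sqrt (c * b))\<^sup>2"
    by (rule sum_squares_bound)
  finally show "(sqrt (a * b) + sqrt (c * d))\<^sup>2 \<le> (a + c) * (b + d)"
    using assms by (simp add: power2_sum algebra_simps)
qed

lemma provide_amount_nonneg:
  assumes "0 < assetA n" "0 < assetB n" "0 < tokens n" "0 \<le> da" "0 \<le> db"
  shows "0 \<le> provide_amount n da db"
proof -
  have "assetA n * assetB n \<le> (assetA n + da) * (assetB n + db)"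
    using assms by (intro mult_mono) auto
  then show ?thesis
    using assms by (simp add: provide_amount_def)
qed

text \<open>Removes the quotient under the root, so that the later computations are linear in square
  roots.\<close>

lemma provide_amount_times_sqrt:
  assumes "0 < assetA n" "0 < assetB n"
  shows "provide_amount n da db * sqrt (assetA n * assetB n) =
    (sqrt ((assetA n + da) * (assetB n + db)) - sqrt (assetA n * assetB n)) * tokens n"
  using assms by (simp add: provide_amount_def real_sqrt_divide field_simps)

text \<open>The value of one token, measured by the geometric mean of the assets.\<close>

definition backing :: "npp \<Rightarrow> real" where
  "backing n = sqrt (assetA n * assetB n) / tokens n"

text \<open>Nonnegative amounts ensure that payments are nonnegative and that the value of a portion
  inherits the monotonicity of \<open>backing\<close>. Zero must be allowed, since a
  \<open>provide\<close> of nothing mints zero.\<close>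

definition solvent :: "npp \<Rightarrow> bool" where
  "solvent n \<longleftrightarrow> 0 < assetA n \<and> 0 < assetB n \<and> 0 < tokens n \<and> (\<forall>m \<in> ran (amount n). 0 \<le> m)"

text \<open>Shows that a permitted swap cannot exhaust the asset that it pays out.\<close>

lemma pos_of_mult_le:
  fixes a b c d :: real
  assumes "0 < a" "0 < b" "0 < c" "a * b \<le> c * d"
  shows "0 < d"
  using assms by (meson less_le_trans mult_pos_pos zero_less_mult_pos)

text \<open>A swap does not lower the product of the assets and keeps the token count. A
  \<open>provide\<close> or \<open>reclaim\<close> multiplies the geometric mean of the assets and
  the token count by the same factor, so \<open>backing\<close> stays constant.\<close>

lemma npp_apply_solvent:
  assumes "solvent n" "npp_permitted n x"
  shows "solvent (npp_apply x n) \<and> backing n \<le> backing (npp_apply x n)"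
proof (cases x)
  case (NInit t da db)
  then show ?thesis using assms by simp
next
  case (NSwapAtoB da db)
  then have *: "assetA n * assetB n \<le> (assetA n + da) * (assetB n + db)" "0 < da"
    using assms by auto
  then have "0 < assetB n + db"
    using assms by (intro pos_of_mult_le[OF _ _ _ *(1)]) (auto simp: solvent_def)
  with NSwapAtoB * show ?thesis using assms
    by (auto simp: solvent_def backing_def divide_right_mono)
next
  case (NSwapBtoA db da)
  then have *: "assetA n * assetB n \<le> (assetB n + db) * (assetA n + da)" "0 < db"
    using assms by (auto simp: mult.commute)
  then have "0 < assetA n + da"
    using assms by (intro pos_of_mult_le[OF _ _ _ *(1)]) (auto simp: solvent_def)
  with NSwapBtoA * show ?thesis using assms
    by (auto simp: solvent_def backing_def divide_right_mono mult.commute)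
next
  case (NProvide t da db)
  then have n: "0 < assetA n" "0 < assetB n" "0 < tokens n" "0 \<le> da" "0 \<le> db"
    using assms by (auto simp: solvent_def)
  let ?m = "provide_amount n da db"
  have m: "0 \<le> ?m"
    using n by (rule provide_amount_nonneg)
  \<comment> \<open>This is the equality of the two backings after cross-multiplication.\<close>
  have "sqrt (assetA n * assetB n) * (tokens n + ?m) =
      sqrt ((assetA n + da) * (assetB n + db)) * tokens n"
    using provide_amount_times_sqrt[OF n(1,2), of da db] by (simp add: algebra_simps)
  then have "backing (npp_apply x n) = backing n"
    using NProvide n m by (simp add: backing_def frac_eq_eq add_pos_nonneg)
  moreover have "solvent (npp_apply x n)"
    using NProvide assms(1) n m by (auto simp: solvent_def ran_def)
  ultimately show ?thesis by simp
next
  case (NReclaim t)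
  then obtain m where m: "amount n t = Some m" "m < tokens n"
    using assms by auto
  then have n: "0 < assetA n" "0 < assetB n" "0 < tokens n" "0 \<le> m"
    using assms(1) by (auto simp: solvent_def ran_def)
  \<comment> \<open>The common factor by which the \<open>reclaim\<close> shrinks both assets and
    the token count.\<close>
  define q where "q = 1 - m / tokens n"
  have q: "0 < q"
    using m n by (simp add: q_def)
  have eqs: "assetA (npp_apply x n) = assetA n * q" "assetB (npp_apply x n) = assetB n * q"
      "tokens (npp_apply x n) = tokens n * q" "amount (npp_apply x n) = amount n"
    using NReclaim m n by (auto simp: reclaim_values_def q_def field_simps)
  have "assetA n * q * (assetB n * q) = (assetA n * assetB n) * q\<^sup>2"
    by (simp add: power2_eq_square)
  then have "sqrt (assetA n * q * (assetB n * q)) = sqrt (assetA n * assetB n) * q"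
    using q by (simp only: real_sqrt_mult[of _ "q\<^sup>2"] real_sqrt_abs abs_of_pos)
  then have "backing (npp_apply x n) = backing n"
    using q by (simp add: backing_def eqs)
  moreover have "solvent (npp_apply x n)"
    using assms(1) q by (simp add: solvent_def eqs)
  ultimately show ?thesis by simp
qed

lemma npp_trace_solvent: "npp_trace \<tau> \<Longrightarrow> solvent (npp_final \<tau>)"
proof (induction rule: npp_trace.induct)
  case (init da db t)
  then show ?case by (simp add: solvent_def)
next
  case (step \<tau> x)
  then show ?case using npp_apply_solvent by simp
qed

lemma npp_trace_paid_nonneg:
  assumes "npp_trace \<tau>" "paid (npp_final \<tau>) t = Some (a', b')"
  shows "0 \<le> a' \<and> 0 \<le> b'"
  using assms
proof (induction rule: npp_trace.induct)
  case (init da db t)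
  then show ?case by simp
next
  case (step \<tau> x)
  note s = npp_trace_solvent[OF step(1)]
  show ?case
  proof (cases "x = NReclaim t")
    case True
    then obtain m where "amount (npp_final \<tau>) t = Some m"
      using step.hyps by auto
    then show ?thesis
      using s step.prems True by (auto simp: reclaim_values_def solvent_def ran_def)
  next
    case False
    then have "paid (npp_final \<tau>) t = Some (a', b')"
      using step by (cases x) (auto split: if_splits)
    then show ?thesis by (rule step.IH)
  qed
qed

section \<open>Product preservation in a single pool\<close>

definition deposit :: "npp_op \<Rightarrow> portion \<Rightarrow> real \<Rightarrow> real \<Rightarrow> bool" where
  "deposit x t da db \<longleftrightarrow> x = NInit t da db \<or> x = NProvide t da db"

lemma npp_trace_paid_amount:
  "npp_trace \<tau> \<Longrightarrow> paid (npp_final \<tau>) t = Some v \<Longrightarrow> \<exists>m. amount (npp_final \<tau>) t = Some m"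
proof (induction rule: npp_trace.induct)
  case (init da db t)
  then show ?case by simp
next
  case (step \<tau> x)
  then show ?case by (cases x) (auto split: if_splits)
qed

text \<open>Valued at the backing before the deposit, the new portion is worth the growth of the
  geometric mean of the assets, and \<open>sqrt_prod_add_le\<close> bounds this growth from
  below.\<close>

lemma backing_provide_amount:
  assumes "solvent n" "0 \<le> da" "0 \<le> db"
  shows "sqrt (da * db) \<le> provide_amount n da db * backing n"
proof -
  have n: "0 < assetA n" "0 < assetB n" "0 < tokens n"
    using assms(1) by (auto simp: solvent_def)
  have "provide_amount n da db * backing n =
      sqrt ((assetA n + da) * (assetB n + db)) - sqrt (assetA n * assetB n)"
    using provide_amount_times_sqrt[OF n(1,2), of da db] n(3) by (simp add: backing_def)
  then show ?thesis
    using sqrt_prod_add_le[of "assetA n" "assetB n" da db] n assms by simp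
qed

lemma prod_reclaim_values:
  assumes "solvent n" "amount n t = Some m"
  shows "fst (reclaim_values n t) * snd (reclaim_values n t) = (m * backing n)\<^sup>2"
  using assms
  by (simp add: reclaim_values_def backing_def solvent_def power2_eq_square field_simps
      flip: real_sqrt_mult)

text \<open>The induction follows a portion through its life: the second clause bounds its value
  while \<open>backing\<close> grows, and the third records the consequence once it is paid. The
  first clause permits squaring the bound.\<close>

lemma npp_trace_deposit:
  assumes "npp_trace \<tau>" "x \<in> set \<tau>" "deposit x t da db"
  shows "0 \<le> da * db \<and>
    (\<exists>m. amount (npp_final \<tau>) t = Some m \<and> sqrt (da * db) \<le> m * backing (npp_final \<tau>)) \<and>
    (\<forall>a' b'. paid (npp_final \<tau>) t = Some (a', b') \<longrightarrow> da * db \<le> a' * b')"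
  using assms
proof (induction rule: npp_trace.induct)
  case (init da db t)
  then show ?case by (auto simp: deposit_def backing_def)
next
  case (step \<tau> y)
  let ?n = "npp_final \<tau>"
  note s = npp_trace_solvent[OF step(1)]
  have s': "backing ?n \<le> backing (npp_apply y ?n)"
    using npp_apply_solvent[OF s step(2)] by auto
  show ?case
  proof (cases "x \<in> set \<tau>")
    case True
    then obtain m where m: "0 \<le> da * db" "amount ?n t = Some m" "sqrt (da * db) \<le> m * backing ?n"
        and paid: "\<And>a' b'. paid ?n t = Some (a', b') \<Longrightarrow> da * db \<le> a' * b'"
      using step.IH step.prems by auto
    have "0 \<le> m"
      using s m by (auto simp: solvent_def ran_def)
    then have "sqrt (da * db) \<le> m * backing (npp_apply y ?n)"
      using m(3) mult_left_mono[OF s'] by (meson order_trans)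
    moreover have "amount (npp_apply y ?n) t = Some m"
      using m(2) step.hyps(2) by (cases y) auto
    moreover have "da * db \<le> a' * b'" if "paid (npp_apply y ?n) t = Some (a', b')" for a' b'
    proof (cases "y = NReclaim t")
      case True
      \<comment> \<open>At the moment of the \<open>reclaim\<close>, the product of the two returned
        amounts is the square of the value of the portion.\<close>
      have "da * db = (sqrt (da * db))\<^sup>2"
        using m(1) by simp
      also have "\<dots> \<le> (m * backing ?n)\<^sup>2"
        using m(1,3) by (intro power_mono) auto
      also have "\<dots> = a' * b'"
        using that True prod_reclaim_values[OF s m(2)] by simp
      finally show ?thesis .
    next
      case False
      then have "paid ?n t = Some (a', b')"
        using that step.hyps(2) by (cases y) (auto split: if_splits)
      then show ?thesis by (rule paid)
    qed
    ultimately show ?thesis using m(1) by simp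
  next
    case False
    then have y: "y = NProvide t da db"
      using step.prems step.hyps(2) by (auto simp: deposit_def)
    then have d: "0 \<le> da" "0 \<le> db" "amount ?n t = None"
      using step.hyps(2) by auto
    \<comment> \<open>A portion unknown before this \<open>provide\<close> cannot have been paid, so
      the third clause holds vacuously.\<close>
    then have "paid ?n t = None"
      using npp_trace_paid_amount[OF step(1), of t] by (cases "paid ?n t") auto
    moreover have "0 \<le> provide_amount ?n da db"
      using s d by (intro provide_amount_nonneg) (auto simp: solvent_def)
    then have "sqrt (da * db) \<le> provide_amount ?n da db * backing (npp_apply y ?n)"
      using backing_provide_amount[OF s d(1,2)] mult_left_mono[OF s'] by (meson order_trans)
    ultimately show ?thesis
      using d y by simp
  qed
qed

lemma npp_trace_product:
  assumes "npp_trace \<tau>" "x \<in> set \<tau>" "deposit x t da db" "paid (npp_final \<tau>) t = Some (a', b')"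
  shows "da * db \<le> a' * b'"
  using npp_trace_deposit[OF assms(1-3)] assms(4) by blast


section \<open>The retroactive pool\<close>

text \<open>A pending \<open>provide\<close> owes nothing, because its assets enter the pool at
  once; only a \<open>reclaim\<close> defers the change of the assets.\<close>

fun payment :: "npp \<Rightarrow> unresolved \<Rightarrow> real \<times> real" where
  "payment n (Minting t) = (0, 0)"
| "payment n (Paying t) = the (paid n t)"

text \<open>The witness \<open>P\<close> in \<open>waiting\<close> says that the part of a virtual trace up to the pending \<open>reclaim\<close>
  depends only on the choices for the locks that still block it. In \<open>balanceA\<close> and \<open>balanceB\<close>, a
  virtual pool differs from the pool itself by the active locks that it executes and by the pending
  payments.\<close>

locale consistent_pool =
  fixes s :: retro_pool
  assumes finite_active: "finite (active s)"
    and finite_virtual: "finite (virtual s)"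
    and active_granted: "active s \<subseteq> granted s"
    and choice_granted: "(\<rho>, \<tau>) \<in> virtual s \<Longrightarrow> \<rho> \<subseteq> granted s"
    and ex_choice: "X \<subseteq> active s \<Longrightarrow> \<exists>\<rho> \<tau>. (\<rho>, \<tau>) \<in> virtual s \<and> \<rho> \<inter> active s = X"
    and virtual_unique: "(\<rho>, \<tau>) \<in> virtual s \<Longrightarrow> (\<rho>', \<tau>') \<in> virtual s \<Longrightarrow>
      \<rho> \<inter> active s = \<rho>' \<inter> active s \<Longrightarrow> \<tau> = \<tau>'"
    and npp_trace: "(\<rho>, \<tau>) \<in> virtual s \<Longrightarrow> npp_trace \<tau>"
    and dom_amount: "(\<rho>, \<tau>) \<in> virtual s \<Longrightarrow> dom (amount (npp_final \<tau>)) = minted s"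
    and paid: "(\<rho>, \<tau>) \<in> virtual s \<Longrightarrow> paid s t = Some v \<Longrightarrow> paid (npp_final \<tau>) t = Some v"
    and waiting_active: "(u, W) \<in> set (waiting s) \<Longrightarrow> W \<subseteq> active s"
    and waiting: "(Paying t, W) \<in> set (waiting s) \<Longrightarrow>
      \<exists>P. \<forall>(\<rho>, \<tau>) \<in> virtual s. prefix (P (\<rho> \<inter> W)) \<tau> \<and> paid (npp_final (P (\<rho> \<inter> W))) t \<noteq> None"
    and balanceA: "(\<rho>, \<tau>) \<in> virtual s \<Longrightarrow>
      assetA s + (\<Sum>L \<in> \<rho> \<inter> active s. lock_da L) =
      assetA (npp_final \<tau>) + (\<Sum>(u, W) \<leftarrow> waiting s. fst (payment (npp_final \<tau>) u))"
    and balanceB: "(\<rho>, \<tau>) \<in> virtual s \<Longrightarrow>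
      assetB s + (\<Sum>L \<in> \<rho> \<inter> active s. lock_db L) =
      assetB (npp_final \<tau>) + (\<Sum>(u, W) \<leftarrow> waiting s. snd (payment (npp_final \<tau>) u))"
begin

text \<open>Virtual pools perform a \<open>reclaim\<close> immediately, so the \<open>the\<close> in
  \<open>payment\<close> never meets \<open>None\<close> for a pending operation.\<close>

lemma waiting_paid:
  assumes "(Paying t, W) \<in> set (waiting s)" "(\<rho>, \<tau>) \<in> virtual s"
  shows "\<exists>v. paid (npp_final \<tau>) t = Some v"
  using waiting[OF assms(1)] assms(2) npp_trace[OF assms(2)] paid_prefix by fastforce

lemma payment_apply:
  assumes "(u, W) \<in> set (waiting s)" "(\<rho>, \<tau>) \<in> virtual s" "npp_permitted (npp_final \<tau>) x"
  shows "payment (npp_apply x (npp_final \<tau>)) u = payment (npp_final \<tau>) u"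
proof (cases u)
  case (Paying t)
  then show ?thesis
    using waiting_paid[of t W \<rho> \<tau>] paid_npp_apply[OF assms(3)] assms by fastforce
qed simp

lemma payment_nonneg:
  assumes "(u, W) \<in> set (waiting s)" "(\<rho>, \<tau>) \<in> virtual s"
  shows "0 \<le> fst (payment (npp_final \<tau>) u) \<and> 0 \<le> snd (payment (npp_final \<tau>) u)"
proof (cases u)
  case (Paying t)
  then show ?thesis
    using waiting_paid[of t W \<rho> \<tau>] npp_trace_paid_nonneg[OF npp_trace] assms by fastforce
qed simp

lemma assets_pos: "0 < assetA s \<and> 0 < assetB s"
proof -
  \<comment> \<open>In the pool that cancels every active lock, the sum over locks in the balance
    equations is empty.\<close>
  obtain \<rho> \<tau> where v: "(\<rho>, \<tau>) \<in> virtual s" "\<rho> \<inter> active s = {}"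
    using ex_choice[of "{}"] by auto
  have "0 \<le> (\<Sum>(u, W) \<leftarrow> waiting s. fst (payment (npp_final \<tau>) u))"
    "0 \<le> (\<Sum>(u, W) \<leftarrow> waiting s. snd (payment (npp_final \<tau>) u))"
    using payment_nonneg[OF _ v(1)] by (auto intro!: sum_list_nonneg)
  then show ?thesis
    using balanceA[OF v(1)] balanceB[OF v(1)] npp_trace_solvent[OF npp_trace[OF v(1)]] v(2)
    by (simp add: solvent_def)
qed

text \<open>Once no lock blocks the \<open>reclaim\<close>, the witness \<open>P {}\<close> no
  longer depends on the choice. It is a common prefix of all virtual traces, hence a prefix of the
  longest one, and already contains the payment.\<close>

lemma retroactive_trace_paid:
  assumes "(Paying t, {}) \<in> set (waiting s)"
  shows "\<exists>v. paid (npp_final (retroactive_trace s)) t = Some v \<and>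
    (\<forall>(\<rho>, \<tau>) \<in> virtual s. paid (npp_final \<tau>) t = Some v)"
proof -
  obtain P where P: "\<forall>(\<rho>, \<tau>) \<in> virtual s. prefix (P {}) \<tau> \<and> paid (npp_final (P {})) t \<noteq> None"
    using waiting[OF assms] by auto
  obtain \<rho> \<tau> where v: "(\<rho>, \<tau>) \<in> virtual s"
    using ex_choice[of "{}"] by auto
  obtain v where v': "paid (npp_final (P {})) t = Some v"
    using P v by auto
  have p: "prefix (P {}) (retroactive_trace s)"
    unfolding retroactive_trace_def using P v by (intro Longest_common_prefix_max_prefix) auto
  have "prefix (retroactive_trace s) \<tau>"
    unfolding retroactive_trace_def using v by (force intro: Longest_common_prefix_prefix)
  \<comment> \<open>The empty trace records no payment, so \<open>P {}\<close> cannot be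
    empty.\<close>
  moreover have "retroactive_trace s \<noteq> []"
    using p v' by auto
  ultimately have "npp_trace (retroactive_trace s)"
    using npp_trace_prefix npp_trace[OF v] by blast
  then have "paid (npp_final (retroactive_trace s)) t = Some v"
    using paid_prefix p v' by blast
  moreover have "paid (npp_final \<tau>) t = Some v" if "(\<rho>, \<tau>) \<in> virtual s" for \<rho> \<tau>
    using paid_prefix npp_trace P v' that by blast
  ultimately show ?thesis by blast
qed

lemma payment_retroactive_trace:
  assumes "(u, {}) \<in> set (waiting s)" "(\<rho>, \<tau>) \<in> virtual s"
  shows "payment (npp_final (retroactive_trace s)) u = payment (npp_final \<tau>) u"
  using retroactive_trace_paid assms by (cases u) fastforce+

end

section \<open>Finalization of resolved operations\<close>

lemma finalize_simps:
  "active (finalize u s) = active s" "granted (finalize u s) = granted s"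
  "virtual (finalize u s) = virtual s" "waiting (finalize u s) = waiting s"
  "minted (finalize u s) = minted s"
  "retroactive_trace (finalize u s) = retroactive_trace s"
  "assetA (finalize u s) = assetA s - fst (payment (npp_final (retroactive_trace s)) u)"
  "assetB (finalize u s) = assetB s - snd (payment (npp_final (retroactive_trace s)) u)"
  "paid (finalize u s) t =
     (if u = Paying t then Some (payment (npp_final (retroactive_trace s)) u) else paid s t)"
  by (cases u; simp add: retroactive_trace_def Let_def split: prod.split)+

text \<open>Finalizing changes no virtual trace, so the retroactive trace is the same throughout the
  fold and all payments can be read off from the initial state.\<close>

lemma fold_finalize:
  "active (fold finalize us s) = active s \<and> granted (fold finalize us s) = granted s \<and>
   virtual (fold finalize us s) = virtual s \<and> waiting (fold finalize us s) = waiting s \<and>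
   minted (fold finalize us s) = minted s \<and>
   assetA (fold finalize us s) =
     assetA s - (\<Sum>u \<leftarrow> us. fst (payment (npp_final (retroactive_trace s)) u)) \<and>
   assetB (fold finalize us s) =
     assetB s - (\<Sum>u \<leftarrow> us. snd (payment (npp_final (retroactive_trace s)) u)) \<and>
   paid (fold finalize us s) t =
     (if Paying t \<in> set us then Some (payment (npp_final (retroactive_trace s)) (Paying t))
      else paid s t)"
  by (induction us arbitrary: s) (auto simp: finalize_simps simp del: finalize.simps)

lemma finalize_ready_simps [simp]:
  "active (finalize_ready s) = active s" "granted (finalize_ready s) = granted s"
  "virtual (finalize_ready s) = virtual s" "minted (finalize_ready s) = minted s"
  "waiting (finalize_ready s) = filter (\<lambda>(u, W). W \<noteq> {}) (waiting s)"
  by (simp_all add: finalize_ready_def fold_finalize)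

lemma paid_finalize_ready:
  "paid (finalize_ready s) t =
     (if (Paying t, {}) \<in> set (waiting s)
      then Some (payment (npp_final (retroactive_trace s)) (Paying t)) else paid s t)"
  by (auto simp: finalize_ready_def fold_finalize retroactive_trace_def image_iff)

lemma sum_list_filter_split:
  fixes f :: "'a \<Rightarrow> real"
  shows "sum_list (map f xs) =
    sum_list (map f (filter P xs)) + sum_list (map f (filter (\<lambda>x. \<not> P x) xs))"
  by (induction xs) auto

text \<open>The finalized payments leave the pending sum on the virtual side of the balance and are
  subtracted from the assets of the pool on the other side.\<close>

lemma (in consistent_pool) consistent_finalize_ready: "consistent_pool (finalize_ready s)"
proof -
  let ?r = "npp_final (retroactive_trace s)"
  \<comment> \<open>The entries that are no longer blocked are evaluated in the retroactive trace,
    which gives the same payments as every virtual pool.\<close>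
  have split: "(\<Sum>(u, W) \<leftarrow> waiting s. g (payment (npp_final \<tau>) u)) =
      (\<Sum>(u, W) \<leftarrow> filter (\<lambda>(u, W). W \<noteq> {}) (waiting s). g (payment (npp_final \<tau>) u)) +
      (\<Sum>u \<leftarrow> map fst (filter (\<lambda>(u, W). W = {}) (waiting s)). g (payment ?r u))"
    if "(\<rho>, \<tau>) \<in> virtual s" for \<rho> \<tau> and g :: "real \<times> real \<Rightarrow> real"
  proof -
    have ready: "map (\<lambda>(u, W). g (payment (npp_final \<tau>) u)) (filter (\<lambda>(u, W). W = {}) (waiting s)) =
        map (\<lambda>u. g (payment ?r u)) (map fst (filter (\<lambda>(u, W). W = {}) (waiting s)))"
      using payment_retroactive_trace[OF _ that] by auto
    have neg: "(\<lambda>x. \<not> (case x of (u, W) \<Rightarrow> W \<noteq> {})) = (\<lambda>(u :: unresolved, W :: lock set). W = {})"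
      by auto
    show ?thesis
      using sum_list_filter_split[of "\<lambda>(u, W). g (payment (npp_final \<tau>) u)" "waiting s"
          "\<lambda>(u, W). W \<noteq> {}"]
      unfolding neg ready .
  qed
  have assets:
    "assetA (finalize_ready s) = assetA s -
      (\<Sum>u \<leftarrow> map fst (filter (\<lambda>(u, W). W = {}) (waiting s)). fst (payment ?r u))"
    "assetB (finalize_ready s) = assetB s -
      (\<Sum>u \<leftarrow> map fst (filter (\<lambda>(u, W). W = {}) (waiting s)). snd (payment ?r u))"
    by (simp_all add: finalize_ready_def fold_finalize retroactive_trace_def)
  show ?thesis
  proof
    show "finite (active (finalize_ready s))" "finite (virtual (finalize_ready s))"
      "active (finalize_ready s) \<subseteq> granted (finalize_ready s)"
      using finite_active finite_virtual active_granted by auto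
    show "\<exists>\<rho> \<tau>. (\<rho>, \<tau>) \<in> virtual (finalize_ready s) \<and> \<rho> \<inter> active (finalize_ready s) = X"
      if "X \<subseteq> active (finalize_ready s)" for X
      using ex_choice that by simp
    show "W \<subseteq> active (finalize_ready s)" if "(u, W) \<in> set (waiting (finalize_ready s))" for u W
      using waiting_active that by auto
    show "\<exists>P. \<forall>(\<rho>, \<tau>) \<in> virtual (finalize_ready s).
        prefix (P (\<rho> \<inter> W)) \<tau> \<and> paid (npp_final (P (\<rho> \<inter> W))) t \<noteq> None"
      if "(Paying t, W) \<in> set (waiting (finalize_ready s))" for t W
      using waiting that by simp
  next
    fix \<rho> \<tau> assume v: "(\<rho>, \<tau>) \<in> virtual (finalize_ready s)"
    then show "\<rho> \<subseteq> granted (finalize_ready s)" "npp_trace \<tau>"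
      "dom (amount (npp_final \<tau>)) = minted (finalize_ready s)"
      using choice_granted npp_trace dom_amount by auto
    show "\<tau> = \<tau>'" if "(\<rho>', \<tau>') \<in> virtual (finalize_ready s)"
        "\<rho> \<inter> active (finalize_ready s) = \<rho>' \<inter> active (finalize_ready s)" for \<rho>' \<tau>'
      using v that virtual_unique by auto
    show "paid (npp_final \<tau>) t = Some w" if "paid (finalize_ready s) t = Some w" for t w
    proof (cases "(Paying t, {}) \<in> set (waiting s)")
      case True
      then show ?thesis
        using retroactive_trace_paid[OF True] v that by (auto simp: paid_finalize_ready)
    next
      case False
      then show ?thesis
        using paid v that by (auto simp: paid_finalize_ready)
    qed
    show "assetA (finalize_ready s) + (\<Sum>L \<in> \<rho> \<inter> active (finalize_ready s). lock_da L) =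
      assetA (npp_final \<tau>) +
        (\<Sum>(u, W) \<leftarrow> waiting (finalize_ready s). fst (payment (npp_final \<tau>) u))"
      using balanceA[of \<rho> \<tau>] split[of \<rho> \<tau> fst] v by (simp add: assets)
    show "assetB (finalize_ready s) + (\<Sum>L \<in> \<rho> \<inter> active (finalize_ready s). lock_db L) =
      assetB (npp_final \<tau>) +
        (\<Sum>(u, W) \<leftarrow> waiting (finalize_ready s). snd (payment (npp_final \<tau>) u))"
      using balanceB[of \<rho> \<tau>] split[of \<rho> \<tau> snd] v by (simp add: assets)
  qed
qed

section \<open>Preservation of the invariant by the operations\<close>

text \<open>Common treatment of \<open>provide\<close> and \<open>reclaim\<close> before
  finalization. Here \<open>da\<close> and \<open>db\<close> are the immediate changes of the assets
  of the pool itself; the assumption \<open>assets\<close> lets the new pending payment account for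
  the difference to the virtual pools.\<close>

lemma (in consistent_pool) consistent_enqueue:
  assumes s': "active s' = active s" "granted s' = granted s" "paid s' = paid s"
      "virtual s' = (\<lambda>(\<rho>, \<tau>). (\<rho>, \<tau> @ [x])) ` virtual s"
      "waiting s' = waiting s @ [(u, active s)]"
      "assetA s' = assetA s + da" "assetB s' = assetB s + db"
    and permitted: "\<And>\<rho> \<tau>. (\<rho>, \<tau>) \<in> virtual s \<Longrightarrow> npp_permitted (npp_final \<tau>) x"
    and minted: "\<And>\<rho> \<tau>. (\<rho>, \<tau>) \<in> virtual s \<Longrightarrow>
      dom (amount (npp_apply x (npp_final \<tau>))) = minted s'"
    and settled: "\<And>\<rho> \<tau> t. (\<rho>, \<tau>) \<in> virtual s \<Longrightarrow> u = Paying t \<Longrightarrow>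
      paid (npp_apply x (npp_final \<tau>)) t \<noteq> None"
    and assets: "\<And>\<rho> \<tau>. (\<rho>, \<tau>) \<in> virtual s \<Longrightarrow>
      assetA (npp_apply x (npp_final \<tau>)) + fst (payment (npp_apply x (npp_final \<tau>)) u) =
        assetA (npp_final \<tau>) + da \<and>
      assetB (npp_apply x (npp_final \<tau>)) + snd (payment (npp_apply x (npp_final \<tau>)) u) =
        assetB (npp_final \<tau>) + db"
  shows "consistent_pool s'"
proof
  show "finite (active s')" "finite (virtual s')" "active s' \<subseteq> granted s'"
    using finite_active finite_virtual active_granted by (auto simp: s')
  show "\<exists>\<rho> \<tau>. (\<rho>, \<tau>) \<in> virtual s' \<and> \<rho> \<inter> active s' = X" if "X \<subseteq> active s'" for X
    using ex_choice[of X] that by (fastforce simp: s'(1,4))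
  show "W \<subseteq> active s'" if "(u', W) \<in> set (waiting s')" for u' W
    using waiting_active that by (auto simp: s')
  show "\<exists>P. \<forall>(\<rho>, \<tau>) \<in> virtual s'. prefix (P (\<rho> \<inter> W)) \<tau> \<and> paid (npp_final (P (\<rho> \<inter> W))) t \<noteq> None"
    if w: "(Paying t, W) \<in> set (waiting s')" for t W
  proof (cases "(Paying t, W) \<in> set (waiting s)")
    case True
    then obtain P where "\<forall>(\<rho>, \<tau>) \<in> virtual s.
        prefix (P (\<rho> \<inter> W)) \<tau> \<and> paid (npp_final (P (\<rho> \<inter> W))) t \<noteq> None"
      using waiting by blast
    then have "\<forall>(\<rho>, \<tau>) \<in> virtual s'.
        prefix (P (\<rho> \<inter> W)) \<tau> \<and> paid (npp_final (P (\<rho> \<inter> W))) t \<noteq> None"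
      by (auto simp: s'(4))
    then show ?thesis by blast
  next
    case False
    then have u: "u = Paying t" "W = active s"
      using w by (auto simp: s')
    \<comment> \<open>The new entry waits for all active locks, and a choice for these determines
      the virtual trace. The part up to the new \<open>reclaim\<close> is this trace followed by
      \<open>x\<close>.\<close>
    define P where "P X = (SOME \<tau>. \<exists>\<rho>. (\<rho>, \<tau>) \<in> virtual s \<and> \<rho> \<inter> active s = X)" for X
    have "P (\<rho> \<inter> W) = \<tau>" if "(\<rho>, \<tau>) \<in> virtual s" for \<rho> \<tau>
      unfolding P_def using that u(2) virtual_unique by (intro some_equality) auto
    then show ?thesis
      using settled[OF _ u(1)] by (intro exI[of _ "\<lambda>X. P X @ [x]"]) (auto simp: s'(4))
  qed
next
  fix \<rho> \<tau>' assume "(\<rho>, \<tau>') \<in> virtual s'"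
  then obtain \<tau> where v: "(\<rho>, \<tau>) \<in> virtual s" "\<tau>' = \<tau> @ [x]"
    by (auto simp: s')
  show "\<rho> \<subseteq> granted s'" "npp_trace \<tau>'" "dom (amount (npp_final \<tau>')) = minted s'"
    using v choice_granted[OF v(1)] npp_trace_snoc_iff[OF npp_trace[OF v(1)]] permitted[OF v(1)]
      minted[OF v(1)] by (simp_all add: s')
  show "\<tau>' = \<tau>''" if v': "(\<rho>', \<tau>'') \<in> virtual s'" "\<rho> \<inter> active s' = \<rho>' \<inter> active s'" for \<rho>' \<tau>''
  proof -
    obtain \<tau>0 where 0: "(\<rho>', \<tau>0) \<in> virtual s" "\<tau>'' = \<tau>0 @ [x]"
      using v'(1) by (auto simp: s')
    have "\<tau> = \<tau>0"
      using v'(2) by (intro virtual_unique[OF v(1) 0(1)]) (simp add: s'(1))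
    then show ?thesis
      using v(2) 0(2) by simp
  qed
  show "paid (npp_final \<tau>') t = Some w" if "paid s' t = Some w" for t w
    unfolding v(2) npp_final_snoc
    using that by (intro paid_npp_apply[OF permitted[OF v(1)]] paid[OF v(1)]) (simp add: s'(3))
  have "map (\<lambda>(u, W). payment (npp_final \<tau>') u) (waiting s) =
      map (\<lambda>(u, W). payment (npp_final \<tau>) u) (waiting s)"
    unfolding v(2) npp_final_snoc using payment_apply[OF _ v(1) permitted[OF v(1)]] by auto
  then have "(\<Sum>(u, W) \<leftarrow> waiting s. g (payment (npp_final \<tau>') u)) =
      (\<Sum>(u, W) \<leftarrow> waiting s. g (payment (npp_final \<tau>) u))" for g :: "real \<times> real \<Rightarrow> real"
    by (intro arg_cong[of _ _ sum_list]) auto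
  then have eq: "(\<Sum>(u, W) \<leftarrow> waiting s'. g (payment (npp_final \<tau>') u)) =
      (\<Sum>(u, W) \<leftarrow> waiting s. g (payment (npp_final \<tau>) u)) + g (payment (npp_final \<tau>') u)"
    for g :: "real \<times> real \<Rightarrow> real"
    by (simp add: s'(5))
  note assets = assets[OF v(1), folded npp_final_snoc, folded v(2)]
  show "assetA s' + (\<Sum>L \<in> \<rho> \<inter> active s'. lock_da L) =
      assetA (npp_final \<tau>') + (\<Sum>(u, W) \<leftarrow> waiting s'. fst (payment (npp_final \<tau>') u))"
    using balanceA[OF v(1)] assets unfolding eq s'(1,6) by linarith
  show "assetB s' + (\<Sum>L \<in> \<rho> \<inter> active s'. lock_db L) =
      assetB (npp_final \<tau>') + (\<Sum>(u, W) \<leftarrow> waiting s'. snd (payment (npp_final \<tau>') u))"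
    using balanceB[OF v(1)] assets unfolding eq s'(1,7) by linarith
qed

text \<open>In the copy of a trace that executes the new lock, the swap moves the virtual assets by
  exactly the term that the lock adds to the sum over active locks.\<close>

lemma (in consistent_pool) consistent_grant_lock:
  assumes L: "L \<notin> granted s"
    and permitted: "\<And>\<rho> \<tau>. (\<rho>, \<tau>) \<in> virtual s \<Longrightarrow> npp_permitted (npp_final \<tau>) x"
    and effect: "\<And>n. npp_apply x n = n\<lparr>assetA := assetA n + lock_da L, assetB := assetB n + lock_db L\<rparr>"
  shows "consistent_pool (grant_lock L x s)"
proof -
  let ?s = "grant_lock L x s"
  have s': "active ?s = insert L (active s)" "granted ?s = insert L (granted s)"
      "paid ?s = paid s" "minted ?s = minted s" "waiting ?s = waiting s"
      "assetA ?s = assetA s" "assetB ?s = assetB s"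
      "virtual ?s = virtual s \<union> (\<lambda>(\<rho>, \<tau>). (insert L \<rho>, \<tau> @ [x])) ` virtual s"
    by (auto simp: grant_lock_def)
  \<comment> \<open>Freshness makes every old choice count as canceling \<open>L\<close> and keeps
    the old witnesses for pending payments valid.\<close>
  have L': "L \<notin> active s" "\<And>\<rho> \<tau>. (\<rho>, \<tau>) \<in> virtual s \<Longrightarrow> L \<notin> \<rho>"
      "\<And>u W. (u, W) \<in> set (waiting s) \<Longrightarrow> L \<notin> W"
    using L active_granted choice_granted waiting_active by blast+
  have payment: "payment (npp_apply x n) u = payment n u" for n u
    by (cases u) (auto simp: effect)
  have cases: "\<And>Q. (\<rho>, \<tau>) \<in> virtual ?s \<Longrightarrow> ((\<rho>, \<tau>) \<in> virtual s \<Longrightarrow> Q) \<Longrightarrow>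
      (\<And>\<rho>0 \<tau>0. (\<rho>0, \<tau>0) \<in> virtual s \<Longrightarrow> \<rho> = insert L \<rho>0 \<Longrightarrow> \<tau> = \<tau>0 @ [x] \<Longrightarrow> Q) \<Longrightarrow> Q" for \<rho> \<tau>
    by (auto simp: s')
  show ?thesis
  proof
    show "finite (active ?s)" "finite (virtual ?s)" "active ?s \<subseteq> granted ?s"
      using finite_active finite_virtual active_granted by (auto simp: s')
    show "\<exists>\<rho> \<tau>. (\<rho>, \<tau>) \<in> virtual ?s \<and> \<rho> \<inter> active ?s = X" if "X \<subseteq> active ?s" for X
    proof -
      have "X - {L} \<subseteq> active s"
        using that by (auto simp: s')
      from ex_choice[OF this] obtain \<rho> \<tau> where v: "(\<rho>, \<tau>) \<in> virtual s" "\<rho> \<inter> active s = X - {L}"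
        by blast
      show ?thesis
      proof (cases "L \<in> X")
        case True
        then have "insert L \<rho> \<inter> active ?s = X"
          using v by (auto simp: s')
        moreover have "(insert L \<rho>, \<tau> @ [x]) \<in> virtual ?s"
          using v(1) by (force simp: s')
        ultimately show ?thesis by blast
      next
        case False
        then have "\<rho> \<inter> active ?s = X"
          using v L'(2)[OF v(1)] by (auto simp: s')
        moreover have "(\<rho>, \<tau>) \<in> virtual ?s"
          using v(1) by (simp add: s')
        ultimately show ?thesis by blast
      qed
    qed
    show "W \<subseteq> active ?s" if "(u, W) \<in> set (waiting ?s)" for u W
      using waiting_active that by (auto simp: s')
    show "\<exists>P. \<forall>(\<rho>, \<tau>) \<in> virtual ?s. prefix (P (\<rho> \<inter> W)) \<tau> \<and> paid (npp_final (P (\<rho> \<inter> W))) t \<noteq> None"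
      if "(Paying t, W) \<in> set (waiting ?s)" for t W
    proof -
      have w: "(Paying t, W) \<in> set (waiting s)"
        using that by (simp add: s')
      then have "insert L \<rho> \<inter> W = \<rho> \<inter> W" for \<rho>
        using L'(3) by auto
      moreover obtain P where "\<forall>(\<rho>, \<tau>) \<in> virtual s.
          prefix (P (\<rho> \<inter> W)) \<tau> \<and> paid (npp_final (P (\<rho> \<inter> W))) t \<noteq> None"
        using waiting[OF w] by blast
      ultimately have "\<forall>(\<rho>, \<tau>) \<in> virtual ?s.
          prefix (P (\<rho> \<inter> W)) \<tau> \<and> paid (npp_final (P (\<rho> \<inter> W))) t \<noteq> None"
        by (auto simp: s'(8))
      then show ?thesis by blast
    qed
  next
    fix \<rho> \<tau> assume v: "(\<rho>, \<tau>) \<in> virtual ?s"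
    then show "\<rho> \<subseteq> granted ?s"
      using choice_granted by (auto simp: s')
    show "npp_trace \<tau>"
      using v by (rule cases) (use npp_trace npp_trace.step permitted in blast)+
    show "dom (amount (npp_final \<tau>)) = minted ?s"
      using v by (rule cases) (use dom_amount in \<open>fastforce simp: effect s'(4)\<close>)+
    show "paid (npp_final \<tau>) t = Some w" if "paid ?s t = Some w" for t w
      using v by (rule cases) (use that paid in \<open>fastforce simp: effect s'(3)\<close>)+
    show "\<tau> = \<tau>'" if v': "(\<rho>', \<tau>') \<in> virtual ?s" and eq: "\<rho> \<inter> active ?s = \<rho>' \<inter> active ?s" for \<rho>' \<tau>'
      using v
    proof (rule cases)
      assume a: "(\<rho>, \<tau>) \<in> virtual s"
      from v' show ?thesis
      proof (rule cases)
        assume b: "(\<rho>', \<tau>') \<in> virtual s"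
        then have "\<rho> \<inter> active s = \<rho>' \<inter> active s"
          using eq L'(2)[OF a] L'(2)[OF b] by (auto simp: s')
        then show ?thesis using virtual_unique a b by blast
      next
        fix \<rho>0 assume "\<rho>' = insert L \<rho>0"
        then show ?thesis using eq L'(2)[OF a] by (auto simp: s')
      qed
    next
      fix \<rho>0 \<tau>0 assume a: "(\<rho>0, \<tau>0) \<in> virtual s" "\<rho> = insert L \<rho>0" "\<tau> = \<tau>0 @ [x]"
      from v' show ?thesis
      proof (rule cases)
        assume b: "(\<rho>', \<tau>') \<in> virtual s"
        then show ?thesis using eq L'(2)[OF b] a(2) by (auto simp: s')
      next
        fix \<rho>1 \<tau>1 assume b: "(\<rho>1, \<tau>1) \<in> virtual s" "\<rho>' = insert L \<rho>1" "\<tau>' = \<tau>1 @ [x]"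
        then have "\<rho>0 \<inter> active s = \<rho>1 \<inter> active s"
          using eq a(2) L'(1) by (auto simp: s')
        then show ?thesis using virtual_unique[OF a(1) b(1)] a(3) b(3) by blast
      qed
    qed
    have old: "\<rho>0 \<inter> active ?s = \<rho>0 \<inter> active s" if "(\<rho>0, \<tau>0) \<in> virtual s" for \<rho>0 \<tau>0
      using L'(2)[OF that] by (auto simp: s')
    have new: "insert L \<rho>0 \<inter> active ?s = insert L (\<rho>0 \<inter> active s)" for \<rho>0
      by (auto simp: s')
    show "assetA ?s + (\<Sum>L \<in> \<rho> \<inter> active ?s. lock_da L) =
        assetA (npp_final \<tau>) + (\<Sum>(u, W) \<leftarrow> waiting ?s. fst (payment (npp_final \<tau>) u))"
      using v
    proof (rule cases)
      assume a: "(\<rho>, \<tau>) \<in> virtual s"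
      show ?thesis using balanceA[OF a] unfolding old[OF a] by (simp add: s')
    next
      fix \<rho>0 \<tau>0 assume a: "(\<rho>0, \<tau>0) \<in> virtual s" "\<rho> = insert L \<rho>0" "\<tau> = \<tau>0 @ [x]"
      show ?thesis using balanceA[OF a(1)] L'(1) finite_active unfolding a(2,3) new npp_final_snoc payment
        by (simp add: s' effect)
    qed
    show "assetB ?s + (\<Sum>L \<in> \<rho> \<inter> active ?s. lock_db L) =
        assetB (npp_final \<tau>) + (\<Sum>(u, W) \<leftarrow> waiting ?s. snd (payment (npp_final \<tau>) u))"
      using v
    proof (rule cases)
      assume a: "(\<rho>, \<tau>) \<in> virtual s"
      show ?thesis using balanceB[OF a] unfolding old[OF a] by (simp add: s')
    next
      fix \<rho>0 \<tau>0 assume a: "(\<rho>0, \<tau>0) \<in> virtual s" "\<rho> = insert L \<rho>0" "\<tau> = \<tau>0 @ [x]"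
      show ?thesis using balanceB[OF a(1)] L'(1) finite_active unfolding a(2,3) new npp_final_snoc payment
        by (simp add: s' effect)
    qed
  qed
qed

text \<open>\<open>c\<close> tells whether the lock is executed.\<close>

lemma (in consistent_pool) consistent_resolve_lock:
  assumes L: "L \<in> active s"
    and s': "active s' = active s - {L}" "granted s' = granted s" "paid s' = paid s"
      "minted s' = minted s"
      "virtual s' = {(\<rho>, \<tau>) \<in> virtual s. L \<in> \<rho> \<longleftrightarrow> c}"
      "waiting s' = map (\<lambda>(u, W). (u, W - {L})) (waiting s)"
      "assetA s' = assetA s + (if c then lock_da L else 0)"
      "assetB s' = assetB s + (if c then lock_db L else 0)"
  shows "consistent_pool s'"
proof
  show "finite (active s')" "finite (virtual s')" "active s' \<subseteq> granted s'"
    using finite_active active_granted rev_finite_subset[OF finite_virtual, of "virtual s'"]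
    by (auto simp: s')
  show "\<exists>\<rho> \<tau>. (\<rho>, \<tau>) \<in> virtual s' \<and> \<rho> \<inter> active s' = X" if "X \<subseteq> active s'" for X
  proof -
    \<comment> \<open>The decision about \<open>L\<close> is now forced, so a choice for the
      remaining locks is completed by it before the old invariant is applied.\<close>
    let ?X = "if c then insert L X else X"
    have "?X \<subseteq> active s"
      using that L by (auto simp: s')
    from ex_choice[OF this] obtain \<rho> \<tau> where v: "(\<rho>, \<tau>) \<in> virtual s" "\<rho> \<inter> active s = ?X"
      by blast
    have "L \<notin> X"
      using that by (auto simp: s')
    then have "L \<in> \<rho> \<longleftrightarrow> c" "\<rho> \<inter> active s' = X"
      using v(2) L by (auto simp: s' split: if_splits)
    then show ?thesis using v(1) by (auto simp: s')
  qed
  show "W \<subseteq> active s'" if "(u, W) \<in> set (waiting s')" for u W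
    using waiting_active that by (fastforce simp: s')
  show "\<exists>P. \<forall>(\<rho>, \<tau>) \<in> virtual s'. prefix (P (\<rho> \<inter> W)) \<tau> \<and> paid (npp_final (P (\<rho> \<inter> W))) t \<noteq> None"
    if w: "(Paying t, W) \<in> set (waiting s')" for t W
  proof -
    obtain W0 where W0: "(Paying t, W0) \<in> set (waiting s)" "W = W0 - {L}"
      using w by (auto simp: s')
    obtain P where P: "\<forall>(\<rho>, \<tau>) \<in> virtual s.
        prefix (P (\<rho> \<inter> W0)) \<tau> \<and> paid (npp_final (P (\<rho> \<inter> W0))) t \<noteq> None"
      using waiting[OF W0(1)] by blast
    \<comment> \<open>The surviving traces agree on \<open>L\<close>, so the witness can have this
      decision built in and need no longer depend on it.\<close>
    have "\<rho> \<inter> W0 = (\<rho> \<inter> W) \<union> (if c then W0 \<inter> {L} else {})" if "(\<rho>, \<tau>) \<in> virtual s'" for \<rho> \<tau>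
      using that by (auto simp: s' W0(2))
    then show ?thesis
      using P
      by (intro exI[of _ "\<lambda>X. P (X \<union> (if c then W0 \<inter> {L} else {}))"]) (fastforce simp: s')
  qed
next
  fix \<rho> \<tau> assume v': "(\<rho>, \<tau>) \<in> virtual s'"
  then have v: "(\<rho>, \<tau>) \<in> virtual s" "L \<in> \<rho> \<longleftrightarrow> c"
    by (auto simp: s')
  show "\<rho> \<subseteq> granted s'" "npp_trace \<tau>" "dom (amount (npp_final \<tau>)) = minted s'"
    using choice_granted[OF v(1)] npp_trace[OF v(1)] dom_amount[OF v(1)] by (simp_all add: s'(2,4))
  show "\<tau> = \<tau>'" if "(\<rho>', \<tau>') \<in> virtual s'" "\<rho> \<inter> active s' = \<rho>' \<inter> active s'" for \<rho>' \<tau>'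
  proof (rule virtual_unique[OF v(1)])
    show "(\<rho>', \<tau>') \<in> virtual s" "\<rho> \<inter> active s = \<rho>' \<inter> active s"
      using that v by (auto simp: s')
  qed
  show "paid (npp_final \<tau>) t = Some w" if "paid s' t = Some w" for t w
    using that by (intro paid[OF v(1)]) (simp add: s'(3))
  \<comment> \<open>An executed lock passes from the sum over active locks into the assets of the
    pool; a canceled one contributed nothing in the surviving traces.\<close>
  have sum: "(\<Sum>L \<in> \<rho> \<inter> active s. g L) = (if c then g L else 0) + (\<Sum>L \<in> \<rho> \<inter> active s'. g L)"
    for g :: "lock \<Rightarrow> real"
  proof -
    have "\<rho> \<inter> active s = (if c then insert L (\<rho> \<inter> active s') else \<rho> \<inter> active s')"
      using v(2) L by (auto simp: s')
    then show ?thesis using finite_active by (simp add: s')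
  qed
  have pending: "(\<Sum>(u, W) \<leftarrow> waiting s'. g u) = (\<Sum>(u, W) \<leftarrow> waiting s. g u)" for g :: "unresolved \<Rightarrow> real"
    by (simp add: s' comp_def case_prod_unfold)
  show "assetA s' + (\<Sum>L \<in> \<rho> \<inter> active s'. lock_da L) =
      assetA (npp_final \<tau>) + (\<Sum>(u, W) \<leftarrow> waiting s'. fst (payment (npp_final \<tau>) u))"
    using balanceA[OF v(1)] sum[of lock_da] unfolding pending s'(7) by linarith
  show "assetB s' + (\<Sum>L \<in> \<rho> \<inter> active s'. lock_db L) =
      assetB (npp_final \<tau>) + (\<Sum>(u, W) \<leftarrow> waiting s'. snd (payment (npp_final \<tau>) u))"
    using balanceB[OF v(1)] sum[of lock_db] unfolding pending s'(8) by linarith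
qed

lemma consistent_retro_init:
  assumes "0 < da" "0 < db"
  shows "consistent_pool (retro_init t da db)"
  using npp_trace.init[OF assms] by unfold_locales (auto simp: retro_init_def)

context consistent_pool
begin

text \<open>Outputs are negative, so the maximum is the smallest amount paid out. It is attained
  because there are finitely many virtual pools and at least one, hence it is still
  negative.\<close>

lemma Max_output:
  assumes "\<And>\<rho> \<tau>. (\<rho>, \<tau>) \<in> virtual s \<Longrightarrow> f (\<rho>, \<tau>) < (0 :: real)" "v \<in> virtual s"
  shows "f v \<le> Max (f ` virtual s) \<and> Max (f ` virtual s) < 0"
proof
  show "f v \<le> Max (f ` virtual s)"
    using finite_virtual assms(2) by simp
  have "Max (f ` virtual s) \<in> f ` virtual s"
    using finite_virtual assms(2) by (intro Max_in) auto
  then show "Max (f ` virtual s) < 0"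
    using assms(1) by (metis imageE surj_pair)
qed

text \<open>Replacing the output of the pool's own permitted swap by the larger maximum leaves more
  of asset B in the pool, so the product condition remains true.\<close>

lemma swapAtoB_permitted:
  assumes "\<forall>(\<rho>, \<tau>) \<in> virtual s. npp_trace (\<tau> @ [NSwapAtoB da (f (\<rho>, \<tau>))])" "(\<rho>, \<tau>) \<in> virtual s"
  shows "npp_permitted (npp_final \<tau>) (NSwapAtoB da (Max (f ` virtual s)))"
proof -
  have permitted: "npp_permitted (npp_final \<tau>') (NSwapAtoB da (f (\<rho>', \<tau>')))"
    if "(\<rho>', \<tau>') \<in> virtual s" for \<rho>' \<tau>'
    using assms(1) that npp_trace_snoc_iff[OF npp_trace[OF that]] by blast
  then have bounds: "f (\<rho>, \<tau>) \<le> Max (f ` virtual s)" "Max (f ` virtual s) < 0"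
    using Max_output[OF _ assms(2), of f] by auto
  have "0 < assetA (npp_final \<tau>)"
    using npp_trace_solvent[OF npp_trace[OF assms(2)]] by (simp add: solvent_def)
  then have "(assetA (npp_final \<tau>) + da) * (assetB (npp_final \<tau>) + f (\<rho>, \<tau>)) \<le>
      (assetA (npp_final \<tau>) + da) * (assetB (npp_final \<tau>) + Max (f ` virtual s))"
    using bounds(1) permitted[OF assms(2)] by (intro mult_left_mono) auto
  then show ?thesis
    using permitted[OF assms(2)] bounds(2) by auto
qed

lemma swapBtoA_permitted:
  assumes "\<forall>(\<rho>, \<tau>) \<in> virtual s. npp_trace (\<tau> @ [NSwapBtoA db (f (\<rho>, \<tau>))])" "(\<rho>, \<tau>) \<in> virtual s"
  shows "npp_permitted (npp_final \<tau>) (NSwapBtoA db (Max (f ` virtual s)))"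
proof -
  have permitted: "npp_permitted (npp_final \<tau>') (NSwapBtoA db (f (\<rho>', \<tau>')))"
    if "(\<rho>', \<tau>') \<in> virtual s" for \<rho>' \<tau>'
    using assms(1) that npp_trace_snoc_iff[OF npp_trace[OF that]] by blast
  then have bounds: "f (\<rho>, \<tau>) \<le> Max (f ` virtual s)" "Max (f ` virtual s) < 0"
    using Max_output[OF _ assms(2), of f] by auto
  have "0 < assetB (npp_final \<tau>)"
    using npp_trace_solvent[OF npp_trace[OF assms(2)]] by (simp add: solvent_def)
  then have "(assetA (npp_final \<tau>) + f (\<rho>, \<tau>)) * (assetB (npp_final \<tau>) + db) \<le>
      (assetA (npp_final \<tau>) + Max (f ` virtual s)) * (assetB (npp_final \<tau>) + db)"
    using bounds(1) permitted[OF assms(2)] by (intro mult_right_mono) auto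
  then show ?thesis
    using permitted[OF assms(2)] bounds(2) by auto
qed

lemma consistent_retro_step:
  assumes "retro_step s x s'"
  shows "consistent_pool s'"
  using assms
proof cases
  case (lockSwapAtoB da f \<beta> L i)
  have "consistent_pool (grant_lock L (NSwapAtoB da \<beta>) s)"
    using lockSwapAtoB swapAtoB_permitted by (intro consistent_grant_lock) auto
  then show ?thesis using lockSwapAtoB(2) by simp
next
  case (lockSwapBtoA db f \<alpha> L i)
  have "consistent_pool (grant_lock L (NSwapBtoA db \<alpha>) s)"
    using lockSwapBtoA swapBtoA_permitted by (intro consistent_grant_lock) auto
  then show ?thesis using lockSwapBtoA(2) by simp
next
  case (execute L)
  show ?thesis
    unfolding execute resolve_lock_def
    by (rule consistent_pool.consistent_finalize_ready, rule consistent_resolve_lock[of L _ True])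
      (use execute in auto)
next
  case (cancel L)
  show ?thesis
    unfolding cancel resolve_lock_def
    by (rule consistent_pool.consistent_finalize_ready, rule consistent_resolve_lock[of L _ False])
      (use cancel in auto)
next
  case (provide da db t)
  have "amount (npp_final \<tau>) t = None" if "(\<rho>, \<tau>) \<in> virtual s" for \<rho> \<tau>
    using dom_amount[OF that] provide(5) by auto
  then show ?thesis
    unfolding provide(2)
    by (intro consistent_pool.consistent_finalize_ready
        consistent_enqueue[where x = "NProvide t da db" and u = "Minting t" and da = da and db = db])
      (use provide dom_amount in \<open>auto simp: extend_virtual_def\<close>)
next
  case (reclaim t m)
  have permitted: "npp_permitted (npp_final \<tau>) (NReclaim t)" if "(\<rho>, \<tau>) \<in> virtual s" for \<rho> \<tau>
    using reclaim(6) that npp_trace_snoc_iff[OF npp_trace[OF that]] by blast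
  show ?thesis
    unfolding reclaim(2)
  \<comment> \<open>Both changes are zero: a \<open>reclaim\<close> leaves the assets of the pool
    untouched until it is finalized.\<close>
  proof (intro consistent_pool.consistent_finalize_ready
        consistent_enqueue[where x = "NReclaim t" and u = "Paying t" and da = 0 and db = 0])
    show "dom (amount (npp_apply (NReclaim t) (npp_final \<tau>))) = minted (extend_virtual (NReclaim t)
        (s\<lparr>requested := insert t (requested s), waiting := waiting s @ [(Paying t, active s)]\<rparr>))"
      if "(\<rho>, \<tau>) \<in> virtual s" for \<rho> \<tau>
      using dom_amount[OF that] by (simp add: extend_virtual_def)
  qed (auto simp: extend_virtual_def permitted simp del: npp_permitted.simps)
qed

end

section \<open>The invariant, deposits and reclaims along a trace\<close>

lemma consistent_retro_trace: "retro_trace tr \<Longrightarrow> consistent_pool (snd (last tr))"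
proof (induction rule: retro_trace.induct)
  case (init da db t)
  then show ?case by (simp add: consistent_retro_init)
next
  case (step tr x s)
  then show ?case using consistent_pool.consistent_retro_step by simp
qed

lemma retro_trace_assets_pos: "retro_trace tr \<Longrightarrow> \<forall>(x, s) \<in> set tr. assetA s > 0 \<and> assetB s > 0"
proof (induction rule: retro_trace.induct)
  case (init da db t)
  then show ?case by (simp add: retro_init_def)
next
  case (step tr x s)
  have "consistent_pool s"
    using consistent_retro_trace[OF retro_trace.step[OF step(1,2)]] by simp
  then show ?case
    using step.IH consistent_pool.assets_pos by auto
qed

text \<open>Virtual traces are only copied, extended or discarded, so a deposit once present stays
  in all survivors.\<close>

lemma retro_step_virtual:
  assumes "retro_step s x s'" "(\<rho>', \<tau>') \<in> virtual s'"
  shows "(\<exists>(\<rho>, \<tau>) \<in> virtual s. set \<tau> \<subseteq> set \<tau>') \<and>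
    (\<forall>t da db. x = Provide t da db \<longrightarrow> NProvide t da db \<in> set \<tau>')"
  using assms
  by cases (fastforce simp: grant_lock_def resolve_lock_def extend_virtual_def)+

lemma retro_step_not_Init: "\<not> retro_step s (Init t da db) s'"
  by (auto elim: retro_step.cases)

lemma retro_trace_deposit:
  assumes "retro_trace tr" "(x, s) \<in> set tr" "x = Provide t da db \<or> x = Init t da db"
    "(\<rho>, \<tau>) \<in> virtual (snd (last tr))"
  shows "\<exists>y \<in> set \<tau>. deposit y t da db"
  using assms
proof (induction arbitrary: \<rho> \<tau> rule: retro_trace.induct)
  case (init da db t)
  then show ?case by (auto simp: retro_init_def deposit_def)
next
  case (step tr x' s')
  have v: "(\<rho>, \<tau>) \<in> virtual s'"
    using step.prems by simp
  show ?case
  proof (cases "(x, s) \<in> set tr")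
    case True
    then show ?thesis
      using retro_step_virtual[OF step.hyps(2) v] step.IH[OF True step.prems(2)] by fast
  next
    case False
    then have "x' = Provide t da db"
      using step.prems(1,2) step.hyps(2) retro_step_not_Init by auto
    then show ?thesis
      using retro_step_virtual[OF step.hyps(2) v] by (auto simp: deposit_def)
  qed
qed

text \<open>The progress of a \<open>reclaim\<close> that was requested while the locks in \<open>A\<close> were active.\<close>

definition handled :: "retro_pool \<Rightarrow> portion \<Rightarrow> lock set \<Rightarrow> bool" where
  "handled s t A \<longleftrightarrow> A \<subseteq> granted s \<and>
    (paid s t \<noteq> None \<or> A \<inter> active s \<noteq> {} \<and> (Paying t, A \<inter> active s) \<in> set (waiting s))"

text \<open>The assumption admits an empty set of blocking locks. Such an entry is one that
  finalization pays, which restores the nonemptiness demanded by \<open>handled\<close>.\<close>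

lemma handled_finalize_ready:
  assumes "A \<subseteq> granted s" "paid s t \<noteq> None \<or> (Paying t, A \<inter> active s) \<in> set (waiting s)"
  shows "handled (finalize_ready s) t A"
  using assms by (auto simp: handled_def paid_finalize_ready)

text \<open>The intermediate state \<open>s'\<close> leaves room for the changes that executing or
  canceling makes to the assets and virtual traces before the lock is removed.\<close>

lemma handled_resolve_lock:
  assumes "handled s t A" "active s' = active s" "granted s' = granted s" "paid s' = paid s"
    "waiting s' = waiting s"
  shows "handled (resolve_lock L s') t A"
proof -
  let ?s = "s'\<lparr>active := active s' - {L}, waiting := map (\<lambda>(u, W). (u, W - {L})) (waiting s')\<rparr>"
  have "A \<inter> (active s - {L}) = A \<inter> active s - {L}"
    by blast
  then have "paid ?s t \<noteq> None \<or> (Paying t, A \<inter> active ?s) \<in> set (waiting ?s)"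
    using assms by (force simp: handled_def)
  moreover have "A \<subseteq> granted ?s"
    using assms by (simp add: handled_def)
  ultimately show ?thesis
    unfolding resolve_lock_def by (intro handled_finalize_ready)
qed

text \<open>Here the clause \<open>A \<subseteq> granted s\<close> of \<open>handled\<close> is
  essential: a lock granted later is not in \<open>A\<close> and cannot block the
  \<open>reclaim\<close>.\<close>

lemma handled_grant_lock:
  assumes "handled s t A" "L \<notin> granted s"
  shows "handled (grant_lock L x s) t A"
proof -
  have "A \<inter> insert L (active s) = A \<inter> active s"
    using assms by (auto simp: handled_def)
  then show ?thesis
    using assms by (auto simp: handled_def grant_lock_def)
qed

lemma handled_retro_step:
  assumes "handled s t A" "retro_step s x s'"
  shows "handled s' t A"
  using assms(2)
proof cases
  case provide
  show ?thesis
    unfolding provide(2) by (rule handled_finalize_ready)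
      (use assms(1) in \<open>auto simp: handled_def extend_virtual_def\<close>)
next
  case reclaim
  show ?thesis
    unfolding reclaim(2) by (rule handled_finalize_ready)
      (use assms(1) in \<open>auto simp: handled_def extend_virtual_def\<close>)
qed (auto intro!: handled_grant_lock handled_resolve_lock[OF assms(1)] assms(1))

lemma (in consistent_pool) handled_reclaim:
  assumes "retro_step s (Reclaim t) s'"
  shows "handled s' t (active s')"
  using assms
  by cases (use active_granted in \<open>auto simp: extend_virtual_def intro!: handled_finalize_ready\<close>)

lemma retro_trace_handled:
  assumes "retro_trace tr" "(Reclaim t, s) \<in> set tr"
  shows "handled (snd (last tr)) t (active s)"
  using assms
proof (induction rule: retro_trace.induct)
  case (init da db t)
  then show ?case by simp
next
  case (step tr x s')
  then show ?case
    using handled_retro_step consistent_pool.handled_reclaim[OF consistent_retro_trace[OF step(1)]]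
    by auto
qed

text \<open>The disjointness of the two sets of active locks says that every lock blocking the
  \<open>reclaim\<close> has been resolved by the end of the trace. The conclusion includes that the
  payment has then been made. Later stages are covered because \<open>tr\<close> is arbitrary and
  may end with locks still active.\<close>

theorem theorem3:
  fixes tr :: "(op \<times> retro_pool) list"
  assumes "retro_trace tr"
  shows "(\<forall>(x, s) \<in> set tr. assetA s > 0 \<and> assetB s > 0) \<and>
    (\<forall>i j t \<Delta>a \<Delta>b. j < i \<and> i < length tr \<and> fst (tr ! i) = Reclaim t \<and>
        (fst (tr ! j) = Provide t \<Delta>a \<Delta>b \<or> fst (tr ! j) = Init t \<Delta>a \<Delta>b) \<and>
        active (snd (tr ! i)) \<inter> active (snd (last tr)) = {} \<longrightarrow>
      (\<exists>a' b'. paid (snd (last tr)) t = Some (a', b') \<and> a' * b' \<ge> \<Delta>a * \<Delta>b))"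
proof (intro conjI allI impI)
  show "\<forall>(x, s) \<in> set tr. assetA s > 0 \<and> assetB s > 0"
    using assms by (rule retro_trace_assets_pos)
next
  fix i j t \<Delta>a \<Delta>b
  assume *: "j < i \<and> i < length tr \<and> fst (tr ! i) = Reclaim t \<and>
    (fst (tr ! j) = Provide t \<Delta>a \<Delta>b \<or> fst (tr ! j) = Init t \<Delta>a \<Delta>b) \<and>
    active (snd (tr ! i)) \<inter> active (snd (last tr)) = {}"
  interpret consistent_pool "snd (last tr)"
    using assms by (rule consistent_retro_trace)
  have i: "(Reclaim t, snd (tr ! i)) \<in> set tr"
    using * by (metis nth_mem prod.collapse)
  have "(fst (tr ! j), snd (tr ! j)) \<in> set tr"
    using * by simp
  then have deposit: "\<exists>y \<in> set \<tau>. deposit y t \<Delta>a \<Delta>b" if "(\<rho>, \<tau>) \<in> virtual (snd (last tr))" for \<rho> \<tau>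
    using retro_trace_deposit[OF assms _ _ that] * by blast
  \<comment> \<open>Any virtual pool will do: each contains the deposit and records the same payment
    as the retroactive pool.\<close>
  obtain \<rho> \<tau> where v: "(\<rho>, \<tau>) \<in> virtual (snd (last tr))"
    using ex_choice[of "{}"] by auto
  \<comment> \<open>With no blocking lock left, \<open>handled\<close> excludes that the
    \<open>reclaim\<close> is still waiting.\<close>
  obtain a' b' where paid': "paid (snd (last tr)) t = Some (a', b')"
    using retro_trace_handled[OF assms i] * by (auto simp: handled_def)
  then have "\<Delta>a * \<Delta>b \<le> a' * b'"
    using npp_trace_product[OF npp_trace[OF v]] deposit[OF v] paid[OF v] by blast
  then show "\<exists>a' b'. paid (snd (last tr)) t = Some (a', b') \<and> a' * b' \<ge> \<Delta>a * \<Delta>b"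
    using paid' by blast
qed

end
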